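(* Let $d\ge 1$ be an integer, $\beta>0$, $L>0$. Let $K:\mathbb{R}^d\to\mathbb{R}$ be a kernel satisfying the kernel conditions listed in the context, let $(h_k)_{k\ge1}$ be a sequence of positive numbers with $h_k\sim C_2(\beta,d,L)\,k^{-1/(2\beta+d)}$ as $k\to\infty$ (where $C_2(\beta,d,L)>0$ is a constant), and let $B_n=n^{\beta/(2\beta+d)}$. Then there is a constant $C_4=C_4(d,\beta,L)>0$ such that the following holds. Let $\xi_1,\xi_2,\ldots$ be i.i.d. random vectors in $\mathbb{R}^d$ with a probability density $f\in\Sigma(\beta,L)$, let $$f_n^{WW}(x)=\frac1n\sum_{k=1}^n\frac1{h_k^d}\,K\!\left(\frac{x-\xi_k}{h_k}\right),$$ and let $$\mathbf{Q}_n^{WW}(u)=\sup_{x\in\mathbb{R}^d}\mathbf{P}\left(B_n\,\left|f_n^{WW}(x)-\mathbf{E}f_n^{WW}(x)\right|>u\right).$$ Then for all $u\ge 1$, $$\sup_{n}\ \mathbf{Q}_n^{WW}(u)\le 2\exp\left[-C_4(d,\beta,L)\,u^{\frac{2\beta+d}{\beta+d}}\right].$$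
   Context: Smoothness class. For $\beta>0$, $[\beta]=\max\{j=0,1,2,\ldots: j\le\beta\}$ and $\{\beta\}=\beta-[\beta]$. For $\alpha\in(0,1]$, $H(\alpha,L)$ is the set of functions $g:\mathbb{R}^d\to\mathbb{R}$ with $|g(x)-g(y)|\le L|x-y|^\alpha$ for all $x,y$, where $|\cdot|$ is the Euclidean norm. For a multi-index $m=(m_1,\ldots,m_d)$ of non-negative integers, $|m|=\sum_i m_i$. The class $\Sigma(\beta,L)$ consists of functions $f:\mathbb{R}^d\to\mathbb{R}$ such that for every multi-index $m$ with $|m|\le[\beta]$ the partial derivative $\partial^m f/\partial x^m$ exists and belongs to $H(\{\beta\},L)$. When $\beta$ is an integer, this requirement is understood as: for every $m$ with $|m|=\beta$, the derivative $\partial^m f/\partial x^m$ is continuous and $\sup_{x}|\partial^m f/\partial x^m|\le L$. Kernel conditions. $K:\mathbb{R}^d\to\mathbb{R}$ is measurable with $K(-x)=K(x)$, $\int_{\mathbb{R}^d}K(x)\,dx=1$, $\int_{\mathbb{R}^d}K^2(x)\,dx<\infty$, $K\in C(\mathbb{R}^d)$ (continuous), $\int_{\mathbb{R}^d}|K(x)|\,dx<\infty$, and the orthogonality conditions $\int_{\mathbb{R}^d}x^{m}K(x)\,dx=0$ for all multi-indices $m$ with $1\le|m|\le[\beta]$, where $x^m=x_1^{m_1}\cdots x_d^{m_d}$. The kernel $K$ and the bandwidth sequence $(h_k)$ are fixed throughout. $a_k\sim b_k$ means $a_k/b_k\to1$.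
   Formalization: The kernel K is assumed bounded as well as continuous, since for continuous kernels with ever higher, narrower peaks the bound already fails at n = 1; the constant C_4 is stated for probability spaces on one arbitrary sample-space type, which suffices because the tails depend only on the law. *)

theory Defs
  imports "HOL-Probability.Probability"
begin

section \<open>Multi-indices and partial derivatives\<close>

definition mi_size :: "('d::finite \<Rightarrow> nat) \<Rightarrow> nat" where
  "mi_size m = (\<Sum>i\<in>UNIV. m i)"

definition monomial :: "('d::finite \<Rightarrow> nat) \<Rightarrow> real ^ 'd \<Rightarrow> real" where
  "monomial m x = (\<Prod>i\<in>UNIV. (x $ i) ^ m i)"

definition has_partial ::
  "'d::finite \<Rightarrow> (real ^ 'd \<Rightarrow> real) \<Rightarrow> (real ^ 'd \<Rightarrow> real) \<Rightarrow> bool" where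
  "has_partial i f g \<longleftrightarrow>
     (\<forall>x. ((\<lambda>t. f (x + t *\<^sub>R axis i 1)) has_real_derivative g x) (at 0))"

text \<open>Iterated partial derivatives exist along the list and yield the last function;
  the last entry of the list is the direction of the first differentiation.\<close>

primrec has_iterated_partial ::
  "'d::finite list \<Rightarrow> (real ^ 'd \<Rightarrow> real) \<Rightarrow> (real ^ 'd \<Rightarrow> real) \<Rightarrow> bool" where
  "has_iterated_partial [] f g \<longleftrightarrow> g = f"
| "has_iterated_partial (i # js) f g \<longleftrightarrow>
     (\<exists>k. has_iterated_partial js f k \<and> has_partial i k g)"

text \<open>The multi-index notation presupposes that the derivative does not depend on the order
  of differentiation: every list containing each direction \<open>i\<close> exactly \<open>m i\<close> times yields
  the same function. Such a list exists as the index type is finite, so \<open>g\<close> is unique.\<close>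

definition has_multi_partial ::
  "('d::finite \<Rightarrow> nat) \<Rightarrow> (real ^ 'd \<Rightarrow> real) \<Rightarrow> (real ^ 'd \<Rightarrow> real) \<Rightarrow> bool" where
  "has_multi_partial m f g \<longleftrightarrow>
     (\<forall>js. (\<forall>i. count_list js i = m i) \<longrightarrow> has_iterated_partial js f g)"


section \<open>Smoothness classes\<close>

definition holder_class :: "real \<Rightarrow> real \<Rightarrow> (real ^ 'd::finite \<Rightarrow> real) set" where
  "holder_class \<alpha> L = {g. \<forall>x y. \<bar>g x - g y\<bar> \<le> L * norm (x - y) powr \<alpha>}"

text \<open>The integer case only restricts the derivatives of top order \<open>\<beta>\<close>. The bound on the
  supremum is stated pointwise, since the real supremum of an unbounded set is unspecified.\<close>

definition smooth_class :: "real \<Rightarrow> real \<Rightarrow> (real ^ 'd::finite \<Rightarrow> real) set" where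
  "smooth_class \<beta> L =
     (if \<beta> \<in> \<int>
      then {f. \<forall>m. real (mi_size m) = \<beta> \<longrightarrow>
             (\<exists>g. has_multi_partial m f g \<and> continuous_on UNIV g \<and> (\<forall>x. \<bar>g x\<bar> \<le> L))}
      else {f. \<forall>m. int (mi_size m) \<le> \<lfloor>\<beta>\<rfloor> \<longrightarrow>
             (\<exists>g. has_multi_partial m f g \<and> g \<in> holder_class (frac \<beta>) L)})"


section \<open>Kernels and the Wolverton--Wagner estimator\<close>

text \<open>\<open>C(\<real>\<^sup>d)\<close> is read as the Banach space of bounded continuous functions with the supremum
  norm. Boundedness matters: for a continuous integrable kernel with ever higher and
  narrower peaks, already \<open>K ((x - \<xi> 1) / h 1)\<close> need not have exponential tails,
  uniformly in \<open>x\<close>.\<close>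

definition kernel_conditions :: "real \<Rightarrow> (real ^ 'd::finite \<Rightarrow> real) \<Rightarrow> bool" where
  "kernel_conditions \<beta> K \<longleftrightarrow>
     K \<in> borel_measurable borel \<and>
     (\<forall>x. K (- x) = K x) \<and>
     has_bochner_integral lborel K 1 \<and>
     integrable lborel (\<lambda>x. (K x)\<^sup>2) \<and>
     K \<in> bcontfun \<and>
     integrable lborel (\<lambda>x. \<bar>K x\<bar>) \<and>
     (\<forall>m. 1 \<le> mi_size m \<and> int (mi_size m) \<le> \<lfloor>\<beta>\<rfloor> \<longrightarrow>
        has_bochner_integral lborel (\<lambda>x. monomial m x * K x) 0)"

definition WW_estimator ::
  "(real ^ 'd::finite \<Rightarrow> real) \<Rightarrow> (nat \<Rightarrow> real) \<Rightarrow> (nat \<Rightarrow> 'w \<Rightarrow> real ^ 'd) \<Rightarrow>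
    nat \<Rightarrow> real ^ 'd \<Rightarrow> 'w \<Rightarrow> real" where
  "WW_estimator K h \<xi> n x \<omega> =
     1 / real n * (\<Sum>k=1..n. 1 / h k ^ CARD('d) * K ((x - \<xi> k \<omega>) /\<^sub>R h k))"

definition WW_rate :: "real \<Rightarrow> nat \<Rightarrow> nat \<Rightarrow> real" where
  "WW_rate \<beta> d n = real n powr (\<beta> / (2 * \<beta> + real d))"

definition WW_tail ::
  "'w measure \<Rightarrow> real \<Rightarrow> (real ^ 'd::finite \<Rightarrow> real) \<Rightarrow> (nat \<Rightarrow> real) \<Rightarrow>
    (nat \<Rightarrow> 'w \<Rightarrow> real ^ 'd) \<Rightarrow> nat \<Rightarrow> real \<Rightarrow> real" where
  "WW_tail M \<beta> K h \<xi> n u =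
     (SUP x. measure M {\<omega> \<in> space M.
        WW_rate \<beta> CARD('d) n *
          \<bar>WW_estimator K h \<xi> n x \<omega> - (\<integral>\<omega>'. WW_estimator K h \<xi> n x \<omega>' \<partial>M)\<bar> > u})"

end

theory Submission
  imports Defs
begin

text \<open>Write \<open>D = 2 * \<beta> + d\<close>. The deviation of the estimator is \<open>1 / n\<close> times that of a sum of
  independent variables \<open>X k = K ((x - \<xi> k) / h k) / h k ^ d\<close>, and two facts about them suffice.
  First, \<open>K\<close> is bounded and \<open>h k\<close> is at least a constant times \<open>k powr (- 1 / D)\<close>, so for \<open>k \<le> n\<close>
  each \<open>\<bar>X k\<bar>\<close> is \<open>O (n powr (d / D))\<close>. Second, the second moment of \<open>X k\<close> is at most
  \<open>sup f * (\<integral>K\<^sup>2) / h k ^ d\<close>, hence of the same order \<open>n powr (d / D)\<close>, provided that \<open>sup f\<close> is bounded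
  by a constant that depends on \<open>\<beta>\<close>, \<open>L\<close> and \<open>d\<close> only.

  The bound on \<open>sup f\<close> (\<open>smooth_densities_uniformly_bounded\<close>) rests on the following: moving a
  distance \<open>s \<le> 1\<close> along a coordinate axis, up to \<open>k\<close> times, reaches a point at which \<open>f\<close>,
  up to an additive and a multiplicative constant, is at least as large as at the start. For non-integer \<open>\<beta>\<close> this is the Hoelder condition on \<open>f\<close> itself; for \<open>\<beta> = k\<close>
  the \<open>k\<close>-th difference of \<open>f\<close> along the axis is at most \<open>L * s ^ k\<close>. Doing this along
  every axis, with step lengths given by a point \<open>t\<close> of the unit cube, dominates \<open>f x\<close> by a
  constant plus a multiple of a finite sum of values of \<open>f\<close> at \<open>x\<close> plus dilations of \<open>t\<close>;
  integrating over \<open>t\<close> replaces each of these values by at most the total mass \<open>1\<close>.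

  For the tail, let \<open>a = n powr ((\<beta> + d) / D)\<close>, so that the event says that the centered sum exceeds
  \<open>u * a\<close>. The Chernoff bound with parameter \<open>l\<close> gives \<open>exp (- l * u * a + O (l\<^sup>2 * a\<^sup>2))\<close> while
  \<open>l\<close> times the bound on the summands stays small. The centered sum never exceeds \<open>O (a\<^sup>2)\<close>, so the event is
  empty unless \<open>u\<close> is \<open>O (a)\<close>, and in that range the choice
  \<open>l = c * u powr (\<beta> / (\<beta> + d)) / a\<close> is admissible. It makes \<open>l * u * a\<close> a multiple of
  \<open>u powr (D / (\<beta> + d))\<close>; the quadratic term is of order \<open>c\<^sup>2 * u powr (2 * \<beta> / (\<beta> + d))\<close>,
  which has a smaller exponent and is absorbed for small \<open>c\<close> because \<open>u \<ge> 1\<close>. This is the content of \<open>tail_of_normalized_sum\<close>.\<close>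

section \<open>Uniform bounds for smooth densities\<close>

lemma has_iterated_partial_increment:
  assumes "has_iterated_partial js f g"
  shows "has_iterated_partial js (\<lambda>x. f (x + v) - f x) (\<lambda>x. g (x + v) - g x)"
  using assms
proof (induction js arbitrary: g)
  case Nil
  then show ?case by simp
next
  case (Cons i js)
  then obtain k where k: "has_iterated_partial js f k" "has_partial i k g" by auto
  have "has_partial i (\<lambda>x. k (x + v) - k x) (\<lambda>x. g (x + v) - g x)"
    unfolding has_partial_def
  proof
    fix x
    have "((\<lambda>t. k ((x + v) + t *\<^sub>R axis i 1) - k (x + t *\<^sub>R axis i 1))
        has_real_derivative g (x + v) - g x) (at 0)"
      using k(2) unfolding has_partial_def by (intro DERIV_diff) auto
    then show "((\<lambda>t. k (x + t *\<^sub>R axis i 1 + v) - k (x + t *\<^sub>R axis i 1))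
        has_real_derivative g (x + v) - g x) (at 0)"
      by (simp add: algebra_simps)
  qed
  with Cons.IH[OF k(1)] show ?case by auto
qed

lemma has_partial_bounded_increment:
  assumes "has_partial i f g" and "\<And>x. \<bar>g x\<bar> \<le> L" and "s \<ge> 0"
  shows "\<bar>f (x + s *\<^sub>R axis i 1) - f x\<bar> \<le> L * s"
proof (cases "s = 0")
  case False
  with assms have "0 < s" by simp
  have D: "((\<lambda>t. f (x + t *\<^sub>R axis i 1)) has_real_derivative g (x + t *\<^sub>R axis i 1)) (at t)" for t
  proof -
    have "((\<lambda>r. f ((x + t *\<^sub>R axis i 1) + r *\<^sub>R axis i 1))
        has_real_derivative g (x + t *\<^sub>R axis i 1)) (at 0)"
      using assms(1) unfolding has_partial_def by blast
    then show ?thesis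
      using DERIV_shift[of "\<lambda>t. f (x + t *\<^sub>R axis i 1)" "g (x + t *\<^sub>R axis i 1)" 0 t]
      by (simp add: algebra_simps)
  qed
  from MVT2[OF \<open>0 < s\<close> D] obtain z where
    "f (x + s *\<^sub>R axis i 1) - f x = s * g (x + z *\<^sub>R axis i 1)" by auto
  then show ?thesis using assms(2)[of "x + z *\<^sub>R axis i 1"] \<open>0 < s\<close>
    by (simp add: abs_mult mult.commute)
qed simp

text \<open>Apply the statement for \<open>k\<close> to the increment \<open>y \<mapsto> f (y + s e) - f y\<close>, whose \<open>k\<close>-th derivative
  is at most \<open>L * s\<close> by the mean value theorem. Each increment is estimated by the two values
  that form it, which turns the constant \<open>c\<close> into \<open>2 * c + 1\<close>, and hence gives \<open>2 ^ k - 1\<close>. The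
  same argument bounds the \<open>k\<close>-th finite difference, but here only the sizes of its
  coefficients matter, not their signs.\<close>

lemma iterated_partial_bound_by_translates:
  fixes f :: "real ^ 'd::finite \<Rightarrow> real"
  assumes "has_iterated_partial (replicate k i) f g" and "\<And>x. \<bar>g x\<bar> \<le> L" and "s \<ge> 0"
  shows "\<bar>f x\<bar> \<le> L * s ^ k + (2 ^ k - 1) * (\<Sum>j=1..k. \<bar>f (x + (real j * s) *\<^sub>R axis i 1)\<bar>)"
  using assms(1,2)
proof (induction k arbitrary: f g L x)
  case 0
  then show ?case by simp
next
  case (Suc k)
  let ?e = "s *\<^sub>R axis i 1 :: real ^ 'd"
  let ?a = "\<lambda>j. \<bar>f (x + (real j * s) *\<^sub>R axis i 1)\<bar>"
  obtain g' where g': "has_iterated_partial (replicate k i) f g'" "has_partial i g' g"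
    using Suc.prems(1) by auto
  have "\<bar>g' (y + ?e) - g' y\<bar> \<le> L * s" for y
    using has_partial_bounded_increment[OF g'(2) Suc.prems(2) assms(3)] .
  from Suc.IH[OF has_iterated_partial_increment[OF g'(1)] this, of x]
  have 1: "\<bar>f (x + ?e) - f x\<bar> \<le> L * s * s ^ k + (2 ^ k - 1) * (\<Sum>j=1..k.
      \<bar>f (x + (real j * s) *\<^sub>R axis i 1 + ?e) - f (x + (real j * s) *\<^sub>R axis i 1)\<bar>)" .
  have shift: "x + (real j * s) *\<^sub>R axis i 1 + ?e = x + (real (Suc j) * s) *\<^sub>R axis i 1" for j
    by (simp add: algebra_simps)
  have "(\<Sum>j=1..k. \<bar>f (x + (real j * s) *\<^sub>R axis i 1 + ?e) - f (x + (real j * s) *\<^sub>R axis i 1)\<bar>)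
      \<le> (\<Sum>j=1..k. ?a (Suc j) + ?a j)"
    unfolding shift by (intro sum_mono) (simp add: abs_triangle_ineq4)
  also have "\<dots> = (\<Sum>j=1..k. ?a (Suc j)) + (\<Sum>j=1..k. ?a j)"
    by (simp only: sum.distrib)
  also have "(\<Sum>j=1..k. ?a (Suc j)) = (\<Sum>j=2..Suc k. ?a j)"
    using sum.shift_bounds_cl_Suc_ivl[of ?a 1 k] by (simp only: numeral_2_eq_2 One_nat_def)
  also have "(\<Sum>j=2..Suc k. ?a j) \<le> (\<Sum>j=1..Suc k. ?a j)"
    by (intro sum_mono2) auto
  also have "(\<Sum>j=1..k. ?a j) \<le> (\<Sum>j=1..Suc k. ?a j)"
    by (intro sum_mono2) auto
  finally have 2: "(2 ^ k - 1) * (\<Sum>j=1..k.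
      \<bar>f (x + (real j * s) *\<^sub>R axis i 1 + ?e) - f (x + (real j * s) *\<^sub>R axis i 1)\<bar>)
      \<le> (2 ^ k - 1) * (2 * (\<Sum>j=1..Suc k. ?a j))"
    by (intro mult_left_mono) auto
  have "?a 1 \<le> (\<Sum>j=1..Suc k. ?a j)"
    by (intro member_le_sum) auto
  moreover have "\<bar>f x\<bar> \<le> ?a 1 + \<bar>f (x + ?e) - f x\<bar>" by simp
  ultimately have "\<bar>f x\<bar> \<le> (\<Sum>j=1..Suc k. ?a j) + L * s * s ^ k
      + (2 ^ k - 1) * (2 * (\<Sum>j=1..Suc k. ?a j))"
    using 1 2 by linarith
  also have "\<dots> = L * s ^ Suc k + (2 ^ Suc k - 1) * (\<Sum>j=1..Suc k. ?a j)"
    by (simp add: algebra_simps del: sum.cl_ivl_Suc)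
  finally show ?case .
qed

text \<open>The axes are used one after another: the estimate for the axis \<open>b\<close> is applied at the
  point reached by the previous moves. The step length along \<open>b\<close> is the coordinate \<open>t \<bullet> b\<close>, so
  that the final point is an affine function of \<open>t\<close>, up to the finitely many choices of \<open>c\<close>.\<close>

lemma chain_over_coordinates:
  fixes f :: "'a::euclidean_space \<Rightarrow> real"
  assumes step: "\<And>b x s. b \<in> Basis \<Longrightarrow> 0 \<le> s \<Longrightarrow> s \<le> 1 \<Longrightarrow>
      \<exists>j\<in>{1..k}. f x \<le> A + B * f (x + (real j * s) *\<^sub>R b)"
    and "B \<ge> 0" and t: "\<And>b. b \<in> Basis \<Longrightarrow> 0 \<le> t \<bullet> b \<and> t \<bullet> b \<le> 1"
    and "finite S" and "S \<subseteq> Basis"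
  shows "\<exists>c\<in>Basis \<rightarrow>\<^sub>E {1..k}. f x \<le> A * (\<Sum>i<card S. B ^ i)
           + B ^ card S * f (x + (\<Sum>b\<in>S. (real (c b) * (t \<bullet> b)) *\<^sub>R b))"
  using assms(4,5)
proof (induction S)
  case empty
  obtain b :: 'a where b: "b \<in> Basis" using nonempty_Basis by blast
  have "1 \<in> {1..k}" using step[OF b, of 0 x] by auto
  then have "restrict (\<lambda>_. 1) Basis \<in> (Basis :: 'a set) \<rightarrow>\<^sub>E {1..k}" by auto
  then show ?case by (rule bexI[rotated]) simp
next
  case (insert b S)
  from insert obtain c where c: "c \<in> Basis \<rightarrow>\<^sub>E {1..k}"
    and le: "f x \<le> A * (\<Sum>i<card S. B ^ i)
           + B ^ card S * f (x + (\<Sum>b\<in>S. (real (c b) * (t \<bullet> b)) *\<^sub>R b))" by auto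
  let ?y = "x + (\<Sum>b\<in>S. (real (c b) * (t \<bullet> b)) *\<^sub>R b)"
  have b: "b \<in> Basis" using insert by auto
  obtain j where j: "j \<in> {1..k}" "f ?y \<le> A + B * f (?y + (real j * (t \<bullet> b)) *\<^sub>R b)"
    using step[OF b, of "t \<bullet> b" ?y] t[OF b] by auto
  have "(\<Sum>a\<in>S. (real ((c(b := j)) a) * (t \<bullet> a)) *\<^sub>R a) = (\<Sum>a\<in>S. (real (c a) * (t \<bullet> a)) *\<^sub>R a)"
    using insert.hyps by (intro sum.cong) auto
  then have y: "x + (\<Sum>a\<in>insert b S. (real ((c(b := j)) a) * (t \<bullet> a)) *\<^sub>R a)
      = ?y + (real j * (t \<bullet> b)) *\<^sub>R b"
    using insert.hyps by (simp add: algebra_simps)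
  have "f x \<le> A * (\<Sum>i<card S. B ^ i) + B ^ card S * (A + B * f (?y + (real j * (t \<bullet> b)) *\<^sub>R b))"
    using le j(2) \<open>B \<ge> 0\<close> by (meson add_left_mono mult_left_mono order_trans zero_le_power)
  also have "\<dots> = A * (\<Sum>i<card (insert b S). B ^ i)
      + B ^ card (insert b S) * f (?y + (real j * (t \<bullet> b)) *\<^sub>R b)"
    using insert.hyps by (simp add: algebra_simps)
  finally have "f x \<le> A * (\<Sum>i<card (insert b S). B ^ i)
      + B ^ card (insert b S) * f (x + (\<Sum>a\<in>insert b S. (real ((c(b := j)) a) * (t \<bullet> a)) *\<^sub>R a))"
    unfolding y .
  moreover have "c(b := j) \<in> Basis \<rightarrow>\<^sub>E {1..k}"
    using c j(1) b by (auto simp: PiE_iff extensional_def)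
  ultimately show ?case by blast
qed

text \<open>The Jacobian of the substitution is the product of the dilation factors, which is at
  least \<open>1\<close>.\<close>

lemma nn_integral_dilation_le:
  fixes f :: "'a::euclidean_space \<Rightarrow> ennreal"
  assumes [measurable]: "f \<in> borel_measurable borel" and c: "\<And>b. b \<in> Basis \<Longrightarrow> c b \<ge> 1"
  shows "(\<integral>\<^sup>+t. f (x + (\<Sum>b\<in>Basis. (c b * (t \<bullet> b)) *\<^sub>R b)) \<partial>lborel) \<le> (\<integral>\<^sup>+y. f y \<partial>lborel)"
proof -
  let ?T = "\<lambda>t. x + (\<Sum>b\<in>Basis. (c b * (t \<bullet> b)) *\<^sub>R b)"
  have [measurable]: "?T \<in> borel_measurable borel" by measurable
  have p: "1 \<le> (\<Prod>b\<in>Basis. \<bar>c b\<bar>)"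
    using c by (intro prod_ge_1) (auto intro: order_trans[OF _ abs_ge_self])
  have "c b \<noteq> 0" if "b \<in> Basis" for b using c[OF that] by auto
  then have "(lborel :: 'a measure) = density (distr lborel borel ?T) (\<lambda>_. (\<Prod>b\<in>Basis. \<bar>c b\<bar>))"
    by (intro lborel_affine_euclidean) auto
  then have "(\<integral>\<^sup>+y. f y \<partial>lborel)
      = (\<integral>\<^sup>+y. f y \<partial>density (distr lborel borel ?T) (\<lambda>_. (\<Prod>b\<in>Basis. \<bar>c b\<bar>)))" by simp
  also have "\<dots> = (\<integral>\<^sup>+t. ennreal (\<Prod>b\<in>Basis. \<bar>c b\<bar>) * f (?T t) \<partial>lborel)"
    by (simp add: nn_integral_density nn_integral_distr)
  also have "\<dots> \<ge> (\<integral>\<^sup>+t. f (?T t) \<partial>lborel)"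
  proof (intro nn_integral_mono)
    fix t
    have "1 * f (?T t) \<le> ennreal (\<Prod>b\<in>Basis. \<bar>c b\<bar>) * f (?T t)"
      using p by (intro mult_right_mono) (simp_all add: ennreal_1[symmetric] ennreal_leI del: ennreal_1)
    then show "f (?T t) \<le> ennreal (\<Prod>b\<in>Basis. \<bar>c b\<bar>) * f (?T t)" by simp
  qed
  finally show ?thesis .
qed

text \<open>The function \<open>c\<close> supplied by \<open>chain_over_coordinates\<close> depends on \<open>t\<close> without any
  measurability; summing over all \<open>k ^ DIM('a)\<close> candidates removes the dependence before
  integrating over the unit cube.\<close>

lemma density_le_of_coordinate_step:
  fixes f :: "'a::euclidean_space \<Rightarrow> real"
  assumes [measurable]: "f \<in> borel_measurable borel" and nonneg: "\<And>x. f x \<ge> 0"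
    and int: "(\<integral>\<^sup>+x. ennreal (f x) \<partial>lborel) \<le> 1"
    and step: "\<And>b x s. b \<in> Basis \<Longrightarrow> 0 \<le> s \<Longrightarrow> s \<le> 1 \<Longrightarrow>
      \<exists>j\<in>{1..k}. f x \<le> A + B * f (x + (real j * s) *\<^sub>R b)"
    and "A \<ge> 0" "B \<ge> 0"
  shows "f (x :: 'a) \<le> A * (\<Sum>i<DIM('a). B ^ i) + B ^ DIM('a) * real k ^ DIM('a)"
proof -
  let ?J = "(Basis :: 'a set) \<rightarrow>\<^sub>E {1..k}"
  let ?T = "\<lambda>c t. x + (\<Sum>b\<in>Basis. (real (c b) * (t \<bullet> b)) *\<^sub>R b)"
  let ?A = "A * (\<Sum>i<DIM('a). B ^ i)" and ?B = "B ^ DIM('a)"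
  have fin: "finite ?J" by (intro finite_PiE) auto
  have A0: "?A \<ge> 0" and B0: "?B \<ge> 0" using assms(5,6) by (auto intro!: mult_nonneg_nonneg sum_nonneg)
  have pw: "ennreal (f x) * indicator (cbox 0 One) t
      \<le> ennreal ?A * indicator (cbox 0 One) t + ennreal ?B * (\<Sum>c\<in>?J. ennreal (f (?T c t)))" for t
  proof (cases "t \<in> cbox 0 One")
    case True
    then have "\<And>b. b \<in> Basis \<Longrightarrow> 0 \<le> t \<bullet> b \<and> t \<bullet> b \<le> 1" by (auto simp: mem_box)
    from chain_over_coordinates[OF step assms(6) this finite_Basis order_refl]
    obtain c where c: "c \<in> ?J" "f x \<le> ?A + ?B * f (?T c t)" by blast
    have "f (?T c t) \<le> (\<Sum>c\<in>?J. f (?T c t))"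
      using c(1) fin nonneg by (intro member_le_sum) auto
    then have "f x \<le> ?A + ?B * (\<Sum>c\<in>?J. f (?T c t))"
      using c(2) B0 by (meson add_left_mono mult_left_mono order_trans)
    then have "ennreal (f x) \<le> ennreal (?A + ?B * (\<Sum>c\<in>?J. f (?T c t)))" by (rule ennreal_leI)
    also have "\<dots> = ennreal ?A + ennreal ?B * (\<Sum>c\<in>?J. ennreal (f (?T c t)))"
      using A0 B0 nonneg by (simp add: ennreal_plus ennreal_mult sum_nonneg sum_ennreal)
    finally show ?thesis using True by simp
  qed simp
  have cube: "emeasure lborel (cbox 0 (One :: 'a)) = 1" 
    by (subst emeasure_lborel_cbox) (auto simp: inner_diff_left)
  have "ennreal (f x) = (\<integral>\<^sup>+t. ennreal (f x) * indicator (cbox 0 (One :: 'a)) t \<partial>lborel)"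
    by (simp add: nn_integral_cmult_indicator cube)
  also have "\<dots> \<le> (\<integral>\<^sup>+t. ennreal ?A * indicator (cbox 0 One) t
      + ennreal ?B * (\<Sum>c\<in>?J. ennreal (f (?T c t))) \<partial>lborel)"
    by (intro nn_integral_mono pw)
  also have "\<dots> = ennreal ?A + ennreal ?B * (\<Sum>c\<in>?J. \<integral>\<^sup>+t. ennreal (f (?T c t)) \<partial>lborel)"
    by (simp add: nn_integral_add nn_integral_cmult nn_integral_cmult_indicator nn_integral_sum cube)
  also have "\<dots> \<le> ennreal ?A + ennreal ?B * (\<Sum>c\<in>?J. 1)"
  proof (intro add_left_mono mult_left_mono sum_mono)
    fix c assume "c \<in> ?J"
    then have "\<And>b. b \<in> Basis \<Longrightarrow> 1 \<le> real (c b)" by (force simp: PiE_iff)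
    then have "(\<integral>\<^sup>+t. ennreal (f (?T c t)) \<partial>lborel) \<le> (\<integral>\<^sup>+y. ennreal (f y) \<partial>lborel)"
      by (intro nn_integral_dilation_le[where f = "\<lambda>y. ennreal (f y)" and c = "\<lambda>b. real (c b)"]) auto
    with int show "(\<integral>\<^sup>+t. ennreal (f (?T c t)) \<partial>lborel) \<le> 1" by (rule order_trans[rotated])
  qed auto
  also have "(\<Sum>c\<in>?J. 1 :: ennreal) = ennreal (real k ^ DIM('a))"
    by (simp add: card_PiE ennreal_of_nat_eq_real_of_nat)
  also have "ennreal ?A + ennreal ?B * ennreal (real k ^ DIM('a)) = ennreal (?A + ?B * real k ^ DIM('a))"
    using A0 B0 by (simp add: ennreal_plus ennreal_mult)
  finally show ?thesis using A0 B0 by (subst (asm) ennreal_le_iff) auto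
qed

text \<open>For integer \<open>\<beta>\<close> this comes from the pure derivatives of order \<open>k = \<beta>\<close>; for other \<open>\<beta>\<close> the
  Hoelder condition for the derivative of order zero gives it with \<open>k = 1\<close>. The constants \<open>k\<close>, \<open>A\<close>, \<open>B\<close> are the same for all \<open>f\<close>, as uniformity over the class
  requires.\<close>

lemma smooth_density_coordinate_step:
  fixes \<beta> L :: real
  assumes "\<beta> > 0" "L > 0"
  obtains k A B where "A \<ge> 0" "B \<ge> 0" and
    "\<And>f :: real ^ 'd::finite \<Rightarrow> real. \<And>b x s. f \<in> smooth_class \<beta> L \<Longrightarrow> (\<And>x. f x \<ge> 0) \<Longrightarrow>
       b \<in> Basis \<Longrightarrow> 0 \<le> s \<Longrightarrow> s \<le> 1 \<Longrightarrow>
       \<exists>j\<in>{1..k}. f x \<le> A + B * f (x + (real j * s) *\<^sub>R b)"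
proof (cases "\<beta> \<in> \<int>")
  case True
  then obtain k :: nat where k: "\<beta> = real k" "k \<ge> 1"
    using assms(1) by (metis Ints_cases of_int_of_nat_eq less_eq_Suc_le One_nat_def
        of_int_0_less_iff zero_less_imp_eq_int)
  show thesis
  proof (rule that[of L "2 ^ k * real k" k])
    fix f :: "real ^ 'd \<Rightarrow> real" and b x :: "real ^ 'd" and s :: real
    assume f: "f \<in> smooth_class \<beta> L" "\<And>x. f x \<ge> 0" and b: "b \<in> Basis" and s: "0 \<le> s" "s \<le> 1"
    obtain i where i: "b = axis i 1" using b by (auto simp: Basis_vec_def)
    define m where "m = (\<lambda>l. if l = i then k else 0)"
    have "mi_size m = k" by (simp add: mi_size_def m_def)
    then obtain g where g: "has_multi_partial m f g" "\<forall>x. \<bar>g x\<bar> \<le> L"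
      using f(1) True k by (auto simp: smooth_class_def)
    have "count_list (replicate k i) l = m l" for l
      unfolding m_def by (induction k) auto
    then have it: "has_iterated_partial (replicate k i) f g"
      using g(1) by (simp add: has_multi_partial_def)
    let ?a = "\<lambda>j. f (x + (real j * s) *\<^sub>R b)"
    have "f x \<le> L * s ^ k + (2 ^ k - 1) * (\<Sum>j=1..k. ?a j)"
      using iterated_partial_bound_by_translates[OF it _ s(1), of L x] g(2) f(2) unfolding i by simp
    moreover have "L * s ^ k \<le> L"
      using s assms(2) by (simp add: mult_left_le power_le_one)
    moreover have "(2 ^ k - 1) * (\<Sum>j=1..k. ?a j) \<le> 2 ^ k * (\<Sum>j=1..k. ?a j)"
      using f(2) by (intro mult_right_mono sum_nonneg) auto
    ultimately have le: "f x \<le> L + 2 ^ k * (\<Sum>j=1..k. ?a j)" by linarith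
    \<comment> \<open>A sum of \<open>k\<close> values is at most \<open>k\<close> times the largest of them.\<close>
    have "Max (?a ` {1..k}) \<in> ?a ` {1..k}" using k by (intro Max_in) auto
    then obtain j where j: "j \<in> {1..k}" "?a j = Max (?a ` {1..k})" by auto
    have "(\<Sum>j=1..k. ?a j) \<le> real k * ?a j"
      using sum_bounded_above[of "{1..k}" ?a "?a j"] j by auto
    then have "2 ^ k * (\<Sum>j=1..k. ?a j) \<le> 2 ^ k * (real k * ?a j)" by (intro mult_left_mono) auto
    with le have "f x \<le> L + 2 ^ k * real k * ?a j" by (simp only: mult.assoc)
    with j(1) show "\<exists>j\<in>{1..k}. f x \<le> L + 2 ^ k * real k * f (x + (real j * s) *\<^sub>R b)"
      by blast
  qed (use assms in auto)
next
  case False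
  show thesis
  proof (rule that[of L 1 1])
    fix f :: "real ^ 'd \<Rightarrow> real" and b x :: "real ^ 'd" and s :: real
    assume f: "f \<in> smooth_class \<beta> L" and b: "b \<in> Basis" and s: "0 \<le> s" "s \<le> 1"
    have "mi_size (\<lambda>_ :: 'd. 0) = 0" by (simp add: mi_size_def)
    then obtain g where g: "has_multi_partial (\<lambda>_. 0) f g" "g \<in> holder_class (frac \<beta>) L"
      using f False assms(1) by (auto simp: smooth_class_def dest!: spec[of _ "\<lambda>_ :: 'd. 0"])
    have "g = f" using g(1) unfolding has_multi_partial_def by (auto dest: spec[of _ "[]"])
    have "\<bar>f x - f (x + s *\<^sub>R b)\<bar> \<le> L * norm (x - (x + s *\<^sub>R b)) powr frac \<beta>"
      using g(2) unfolding \<open>g = f\<close> holder_class_def by blast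
    also have "\<dots> = L * s powr frac \<beta>" using b s by simp
    also have "\<dots> \<le> L" using s assms(2) by (simp add: mult_left_le powr_le1)
    finally show "\<exists>j\<in>{1..1}. f x \<le> L + 1 * f (x + (real j * s) *\<^sub>R b)" by auto
  qed (use assms in auto)
qed

lemma smooth_densities_uniformly_bounded:
  fixes \<beta> L :: real
  assumes "\<beta> > 0" "L > 0"
  obtains F where "F > 0" and
    "\<And>f :: real ^ 'd::finite \<Rightarrow> real. \<And>x. f \<in> smooth_class \<beta> L \<Longrightarrow> f \<in> borel_measurable borel \<Longrightarrow>
       (\<And>x. f x \<ge> 0) \<Longrightarrow> (\<integral>\<^sup>+x. ennreal (f x) \<partial>lborel) \<le> 1 \<Longrightarrow> f x \<le> F"
proof -
  obtain k A B where AB: "A \<ge> 0" "B \<ge> 0" and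
    step: "\<And>f :: real ^ 'd::finite \<Rightarrow> real. \<And>b x s. f \<in> smooth_class \<beta> L \<Longrightarrow> (\<And>x. f x \<ge> 0) \<Longrightarrow>
       b \<in> Basis \<Longrightarrow> 0 \<le> s \<Longrightarrow> s \<le> 1 \<Longrightarrow>
       \<exists>j\<in>{1..k}. f x \<le> A + B * f (x + (real j * s) *\<^sub>R b)"
    using smooth_density_coordinate_step[OF assms] by metis
  let ?F = "A * (\<Sum>i<DIM(real ^ 'd). B ^ i) + B ^ DIM(real ^ 'd) * real k ^ DIM(real ^ 'd)"
  show thesis
  proof (rule that[of "?F + 1"])
    have "?F \<ge> 0" using AB by (intro add_nonneg_nonneg mult_nonneg_nonneg sum_nonneg) auto
    then show "?F + 1 > 0" by linarith
  next
    fix f :: "real ^ 'd \<Rightarrow> real" and x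
    assume f: "f \<in> smooth_class \<beta> L" "f \<in> borel_measurable borel" "\<And>x. f x \<ge> 0"
      "(\<integral>\<^sup>+x. ennreal (f x) \<partial>lborel) \<le> 1"
    have "f x \<le> ?F"
      using density_le_of_coordinate_step[OF f(2-4) step[OF f(1,3)] AB] .
    then show "f x \<le> ?F + 1" by linarith
  qed
qed

section \<open>An exponential inequality for bounded independent summands\<close>

lemma exp_le_quadratic:
  fixes y :: real
  assumes "\<bar>y\<bar> \<le> 1"
  shows "exp y \<le> 1 + y + y\<^sup>2"
proof (cases "y \<ge> 0")
  case True
  then show ?thesis using exp_bound[of y] assms by auto
next
  case False
  \<comment> \<open>For negative \<open>y\<close>, estimate the reciprocal \<open>exp (- y)\<close> from below by its Taylor polynomial.\<close>
  define z where "z = - y"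
  have z: "z > 0" using False by (simp add: z_def)
  have "(1 - z + z\<^sup>2) * (1 + z + z\<^sup>2 / 2) = 1 + z\<^sup>2 / 2 + z ^ 3 / 2 + z ^ 4 / 2"
    by (simp add: field_simps power2_eq_square power3_eq_cube power4_eq_xxxx)
  also have "\<dots> \<ge> 1" using z by simp
  finally have "1 / (1 + z + z\<^sup>2 / 2) \<le> 1 - z + z\<^sup>2"
    using z by (subst pos_divide_le_eq) (auto intro: add_pos_nonneg)
  moreover have "1 + z + z\<^sup>2 / 2 \<le> exp z" using z by (intro exp_lower_Taylor_quadratic) auto
  then have "1 / exp z \<le> 1 / (1 + z + z\<^sup>2 / 2)"
    using z by (intro divide_left_mono mult_pos_pos) (auto intro: add_pos_nonneg)
  ultimately have "1 / exp z \<le> 1 - z + z\<^sup>2" by linarith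
  then show ?thesis by (simp add: z_def exp_minus inverse_eq_divide)
qed

context prob_space
begin

lemma bounded_random_variable:
  fixes X :: "'a \<Rightarrow> real"
  assumes "X \<in> borel_measurable M" and "\<And>\<omega>. \<omega> \<in> space M \<Longrightarrow> \<bar>X \<omega>\<bar> \<le> b"
  shows "integrable M X" and "\<bar>expectation X\<bar> \<le> b"
proof -
  show int: "integrable M X"
    using assms by (intro integrable_const_bound[of _ b] AE_I2) auto
  have "\<bar>expectation X\<bar> \<le> expectation (\<lambda>_. b)"
    using assms int by (intro order_trans[OF integral_abs_bound] integral_mono) auto
  then show "\<bar>expectation X\<bar> \<le> b" by (simp add: prob_space)
qed

text \<open>The quadratic bound on \<open>exp\<close> applies to \<open>l * (X - expectation X)\<close>, whose size is at most
  \<open>\<bar>l\<bar> * 2 * b\<close>. Its linear term has expectation zero, and the variance is at most the second moment.\<close>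

lemma centered_mgf_le:
  fixes X :: "'a \<Rightarrow> real"
  assumes [measurable]: "X \<in> borel_measurable M" and bound: "\<And>\<omega>. \<omega> \<in> space M \<Longrightarrow> \<bar>X \<omega>\<bar> \<le> b"
    and second: "expectation (\<lambda>\<omega>. (X \<omega>)\<^sup>2) \<le> v" and "\<bar>l\<bar> * (2 * b) \<le> 1"
  shows "expectation (\<lambda>\<omega>. exp (l * (X \<omega> - expectation X))) \<le> exp (l\<^sup>2 * v)"
proof -
  have int: "integrable M X" and EX: "\<bar>expectation X\<bar> \<le> b"
    using bounded_random_variable[of X b] bound assms(1) by blast+
  have int2: "integrable M (\<lambda>\<omega>. (X \<omega>)\<^sup>2)"
    using power_mono[OF bound, of _ 2] by (intro integrable_const_bound[of _ "b\<^sup>2"] AE_I2) auto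
  define Y where "Y = (\<lambda>\<omega>. X \<omega> - expectation X)"
  have [measurable]: "Y \<in> borel_measurable M" by (simp add: Y_def)
  have lY: "\<bar>l * Y \<omega>\<bar> \<le> 1" if "\<omega> \<in> space M" for \<omega>
  proof -
    have "\<bar>Y \<omega>\<bar> \<le> 2 * b" using bound[OF that] EX by (simp add: Y_def)
    then have "\<bar>l\<bar> * \<bar>Y \<omega>\<bar> \<le> \<bar>l\<bar> * (2 * b)" by (intro mult_left_mono) auto
    then show ?thesis using assms(4) by (simp add: abs_mult)
  qed
  have Yint: "integrable M Y" "integrable M (\<lambda>\<omega>. (Y \<omega>)\<^sup>2)"
    using int int2 by (auto simp: Y_def power2_diff)
  have EY: "expectation Y = 0" using int by (simp add: Y_def prob_space)
  have "expectation (\<lambda>\<omega>. (Y \<omega>)\<^sup>2) \<le> expectation (\<lambda>\<omega>. (X \<omega>)\<^sup>2)"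
    using variance_eq[OF int int2] by (simp add: Y_def)
  then have VY: "expectation (\<lambda>\<omega>. (Y \<omega>)\<^sup>2) \<le> v" using second by linarith
  have "expectation (\<lambda>\<omega>. exp (l * Y \<omega>)) \<le> expectation (\<lambda>\<omega>. 1 + l * Y \<omega> + l\<^sup>2 * (Y \<omega>)\<^sup>2)"
  proof (rule integral_mono)
    show "integrable M (\<lambda>\<omega>. exp (l * Y \<omega>))"
      using lY by (intro integrable_const_bound[of _ "exp 1"] AE_I2) (auto simp: abs_le_iff)
    show "exp (l * Y \<omega>) \<le> 1 + l * Y \<omega> + l\<^sup>2 * (Y \<omega>)\<^sup>2" if "\<omega> \<in> space M" for \<omega>
      using exp_le_quadratic[OF lY[OF that]] by (simp add: power_mult_distrib)
  qed (use Yint in auto)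
  also have "\<dots> = 1 + l\<^sup>2 * expectation (\<lambda>\<omega>. (Y \<omega>)\<^sup>2)"
    using Yint EY by (simp add: prob_space)
  also have "\<dots> \<le> 1 + l\<^sup>2 * v" using VY by (simp add: mult_left_mono)
  also have "\<dots> \<le> exp (l\<^sup>2 * v)" by (rule exp_ge_add_one_self)
  finally show ?thesis by (simp add: Y_def)
qed

text \<open>Chernoff's method: Markov's inequality for \<open>exp (l * S)\<close>, where \<open>S\<close> is the centered sum, and
  independence to factor the expectation. The parameter \<open>l\<close> is left free, so that it can later be
  chosen below the value that optimizes the bound when the constraint on \<open>l\<close> demands it.\<close>

lemma upper_tail_bounded_independent_sum:
  fixes X :: "'i \<Rightarrow> 'a \<Rightarrow> real"
  assumes "finite I" and indep: "indep_vars (\<lambda>_. borel) X I"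
    and bound: "\<And>i \<omega>. i \<in> I \<Longrightarrow> \<omega> \<in> space M \<Longrightarrow> \<bar>X i \<omega>\<bar> \<le> b"
    and second: "\<And>i. i \<in> I \<Longrightarrow> expectation (\<lambda>\<omega>. (X i \<omega>)\<^sup>2) \<le> v"
    and l: "l > 0" "l * (2 * b) \<le> 1"
  shows "prob {\<omega> \<in> space M. (\<Sum>i\<in>I. X i \<omega>) - expectation (\<lambda>\<omega>. \<Sum>i\<in>I. X i \<omega>) \<ge> t}
           \<le> exp (- l * t + l\<^sup>2 * (real (card I) * v))"
proof -
  have meas: "X i \<in> borel_measurable M" if "i \<in> I" for i
    using indep that by (auto simp: indep_vars_def)
  have int: "integrable M (X i)" and EX: "\<bar>expectation (X i)\<bar> \<le> b" if "i \<in> I" for i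
    using bounded_random_variable[of "X i" b] bound meas that by blast+
  define Y where "Y = (\<lambda>i \<omega>. X i \<omega> - expectation (X i))"
  have Ymeas[measurable]: "Y i \<in> borel_measurable M" if "i \<in> I" for i
    using meas[OF that] by (simp add: Y_def)
  have lY: "l * Y i \<omega> \<le> 1" if "i \<in> I" "\<omega> \<in> space M" for i \<omega>
  proof -
    have "Y i \<omega> \<le> 2 * b" using bound[OF that] EX[OF that(1)] by (simp add: Y_def)
    then have "l * Y i \<omega> \<le> l * (2 * b)" using l by (intro mult_left_mono) auto
    with l show ?thesis by linarith
  qed
  have eint: "integrable M (\<lambda>\<omega>. exp (l * Y i \<omega>))" if "i \<in> I" for i
    using lY[OF that] Ymeas[OF that] by (intro integrable_const_bound[of _ "exp 1"] AE_I2) auto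
  have indepY: "indep_vars (\<lambda>_. borel) (\<lambda>i \<omega>. exp (l * Y i \<omega>)) I"
    unfolding Y_def by (rule indep_vars_compose2[OF indep]) measurable
  define S where "S = (\<lambda>\<omega>. \<Sum>i\<in>I. Y i \<omega>)"
  have expS: "exp (l * S \<omega>) = (\<Prod>i\<in>I. exp (l * Y i \<omega>))" for \<omega>
    using assms(1) by (simp add: S_def sum_distrib_left exp_sum)
  have Smeas[measurable]: "S \<in> borel_measurable M" unfolding S_def by measurable
  have Sint: "integrable M (\<lambda>\<omega>. exp (l * S \<omega>))"
    unfolding expS using indep_vars_integrable[OF assms(1) indepY eint] by simp
  have S_eq: "(\<Sum>i\<in>I. X i \<omega>) - expectation (\<lambda>\<omega>. \<Sum>i\<in>I. X i \<omega>) = S \<omega>" for \<omega>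
    using int by (simp add: S_def Y_def sum_subtractf Bochner_Integration.integral_sum)
  have "prob {\<omega> \<in> space M. S \<omega> \<ge> t} = prob {\<omega> \<in> space M. exp (l * S \<omega>) \<ge> exp (l * t)}"
    using l by simp
  also have "\<dots> \<le> expectation (\<lambda>\<omega>. exp (l * S \<omega>)) / exp (l * t)"
    using Sint by (intro integral_Markov_inequality_measure[where A = "{}"]) auto
  also have "expectation (\<lambda>\<omega>. exp (l * S \<omega>)) = (\<Prod>i\<in>I. expectation (\<lambda>\<omega>. exp (l * Y i \<omega>)))"
    unfolding expS using indep_vars_lebesgue_integral[OF assms(1) indepY eint] by simp
  also have "\<dots> \<le> (\<Prod>i\<in>I. exp (l\<^sup>2 * v))"
    unfolding Y_def using l
    by (intro prod_mono conjI centered_mgf_le[OF meas bound second] Bochner_Integration.integral_nonneg) auto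
  also have "\<dots> = exp (l\<^sup>2 * (real (card I) * v))"
    by (simp add: exp_of_nat_mult[symmetric] algebra_simps)
  finally show ?thesis
    unfolding S_eq by (simp add: divide_right_mono exp_diff[symmetric])
qed

lemma tail_bounded_independent_sum:
  fixes X :: "'i \<Rightarrow> 'a \<Rightarrow> real"
  assumes "finite I" and indep: "indep_vars (\<lambda>_. borel) X I"
    and bound: "\<And>i \<omega>. i \<in> I \<Longrightarrow> \<omega> \<in> space M \<Longrightarrow> \<bar>X i \<omega>\<bar> \<le> b"
    and second: "\<And>i. i \<in> I \<Longrightarrow> expectation (\<lambda>\<omega>. (X i \<omega>)\<^sup>2) \<le> v"
    and l: "l > 0" "l * (2 * b) \<le> 1"
  shows "prob {\<omega> \<in> space M. \<bar>(\<Sum>i\<in>I. X i \<omega>) - expectation (\<lambda>\<omega>. \<Sum>i\<in>I. X i \<omega>)\<bar> \<ge> t}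
           \<le> 2 * exp (- l * t + l\<^sup>2 * (real (card I) * v))"
proof -
  have [measurable]: "X i \<in> borel_measurable M" if "i \<in> I" for i
    using indep that by (auto simp: indep_vars_def)
  let ?S = "\<lambda>\<omega>. (\<Sum>i\<in>I. X i \<omega>) - expectation (\<lambda>\<omega>. \<Sum>i\<in>I. X i \<omega>)"
  let ?U = "{\<omega> \<in> space M. ?S \<omega> \<ge> t}"
  let ?V = "{\<omega> \<in> space M. (\<Sum>i\<in>I. - X i \<omega>) - expectation (\<lambda>\<omega>. \<Sum>i\<in>I. - X i \<omega>) \<ge> t}"
  have neg: "indep_vars (\<lambda>_. borel) (\<lambda>i \<omega>. - X i \<omega>) I"
    by (rule indep_vars_compose2[OF indep]) measurable
  have U: "prob ?U \<le> exp (- l * t + l\<^sup>2 * (real (card I) * v))"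
    by (rule upper_tail_bounded_independent_sum[OF assms])
  have V: "prob ?V \<le> exp (- l * t + l\<^sup>2 * (real (card I) * v))"
    by (rule upper_tail_bounded_independent_sum[OF assms(1) neg _ _ l]) (use bound second in auto)
  have "{\<omega> \<in> space M. \<bar>?S \<omega>\<bar> \<ge> t} \<subseteq> ?U \<union> ?V"
    by (auto simp: sum_negf abs_if split: if_splits)
  then have "prob {\<omega> \<in> space M. \<bar>?S \<omega>\<bar> \<ge> t} \<le> prob (?U \<union> ?V)"
    by (intro finite_measure_mono) measurable
  also have "\<dots> \<le> prob ?U + prob ?V" by (intro measure_Un_le) measurable
  finally show ?thesis using U V by linarith
qed

end

section \<open>Moments of the kernel summands\<close>

lemma nn_integral_kernel_rescaled:
  fixes g :: "'a::euclidean_space \<Rightarrow> ennreal"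
  assumes [measurable]: "g \<in> borel_measurable borel" and "c > 0"
  shows "(\<integral>\<^sup>+y. g ((x - y) /\<^sub>R c) \<partial>lborel) = ennreal (c ^ DIM('a)) * (\<integral>\<^sup>+z. g z \<partial>lborel)"
proof -
  have "(lborel :: 'a measure) = density (distr lborel borel (\<lambda>z. x + (- c) *\<^sub>R z)) (\<lambda>_. \<bar>- c\<bar> ^ DIM('a))"
    using \<open>c > 0\<close> by (intro lborel_affine) auto
  then have "(\<integral>\<^sup>+y. g ((x - y) /\<^sub>R c) \<partial>lborel)
      = (\<integral>\<^sup>+y. g ((x - y) /\<^sub>R c) \<partial>density (distr lborel borel (\<lambda>z. x + (- c) *\<^sub>R z)) (\<lambda>_. \<bar>- c\<bar> ^ DIM('a)))"
    by simp
  also have "\<dots> = (\<integral>\<^sup>+z. ennreal (c ^ DIM('a)) * g z \<partial>lborel)"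
    using \<open>c > 0\<close> by (simp add: nn_integral_density nn_integral_distr)
  finally show ?thesis by (simp add: nn_integral_cmult)
qed

text \<open>Replacing \<open>f\<close> by its bound \<open>F\<close> leaves the integral of a rescaled \<open>K\<^sup>2\<close>, and the rescaling cancels
  one of the two factors \<open>1 / c ^ d\<close>. This gain over the trivial bound by the squared supremum is
  what makes the variance of the sum small enough.\<close>

lemma (in prob_space) kernel_summand_second_moment:
  fixes K :: "real ^ 'd::finite \<Rightarrow> real"
  assumes dist: "distributed M lborel \<xi> (\<lambda>x. ennreal (f x))"
    and [measurable]: "K \<in> borel_measurable borel" and K2: "integrable lborel (\<lambda>x. (K x)\<^sup>2)"
    and F: "\<And>x. f x \<le> F" "F \<ge> 0" and "c > 0"
  shows "expectation (\<lambda>\<omega>. (1 / c ^ CARD('d) * K ((x - \<xi> \<omega>) /\<^sub>R c))\<^sup>2)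
           \<le> F * (LINT x|lborel. (K x)\<^sup>2) / c ^ CARD('d)"
proof -
  let ?I = "LINT x|lborel. (K x)\<^sup>2"
  let ?g = "\<lambda>y. (1 / c ^ CARD('d) * K ((x - y) /\<^sub>R c))\<^sup>2"
  have [measurable]: "\<xi> \<in> borel_measurable M" using distributed_measurable[OF dist] by simp
  have [measurable]: "(\<lambda>x. ennreal (f x)) \<in> borel_measurable borel"
    using distributed_borel_measurable[OF dist] by simp
  have "(\<integral>\<^sup>+\<omega>. ennreal (?g (\<xi> \<omega>)) \<partial>M) = (\<integral>\<^sup>+y. ennreal (f y) * ennreal (?g y) \<partial>lborel)"
    by (rule distributed_nn_integral[OF dist, symmetric]) measurable
  also have "\<dots> \<le> (\<integral>\<^sup>+y. ennreal (F * (1 / c ^ CARD('d))\<^sup>2) * ennreal ((K ((x - y) /\<^sub>R c))\<^sup>2) \<partial>lborel)"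
  proof (intro nn_integral_mono)
    fix y
    have "ennreal (f y) * ennreal (?g y) \<le> ennreal F * ennreal (?g y)"
      using F by (intro mult_right_mono ennreal_leI) auto
    also have "\<dots> = ennreal (F * (1 / c ^ CARD('d))\<^sup>2) * ennreal ((K ((x - y) /\<^sub>R c))\<^sup>2)"
      using F(2) by (simp add: ennreal_mult[symmetric] power_divide mult.assoc)
    finally show "ennreal (f y) * ennreal (?g y) \<le> \<dots>" .
  qed
  also have "\<dots> = ennreal (F * (1 / c ^ CARD('d))\<^sup>2) * (ennreal (c ^ CARD('d)) * (\<integral>\<^sup>+z. ennreal ((K z)\<^sup>2) \<partial>lborel))"
    using nn_integral_kernel_rescaled[of "\<lambda>z. ennreal ((K z)\<^sup>2)" c x] \<open>c > 0\<close>
    by (simp add: nn_integral_cmult)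
  also have "(\<integral>\<^sup>+z. ennreal ((K z)\<^sup>2) \<partial>lborel) = ennreal ?I"
    using K2 by (intro nn_integral_eq_integral) auto
  also have "ennreal (F * (1 / c ^ CARD('d))\<^sup>2) * (ennreal (c ^ CARD('d)) * ennreal ?I)
      = ennreal (F * (1 / c ^ CARD('d))\<^sup>2 * (c ^ CARD('d) * ?I))"
    using F(2) \<open>c > 0\<close> by (simp add: ennreal_mult)
  also have "F * (1 / c ^ CARD('d))\<^sup>2 * (c ^ CARD('d) * ?I) = F * ?I / c ^ CARD('d)"
    using \<open>c > 0\<close> by (simp add: field_simps power2_eq_square)
  finally have "(\<integral>\<^sup>+\<omega>. ennreal (?g (\<xi> \<omega>)) \<partial>M) \<le> ennreal (F * ?I / c ^ CARD('d))" .
  then show ?thesis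
    using F(2) \<open>c > 0\<close> by (subst integral_eq_nn_integral) (auto intro!: enn2real_leI)
qed

text \<open>The limit bounds the ratio below by \<open>1 / 2\<close> from some index on, and the finitely many earlier
  ratios are positive.\<close>

lemma bandwidth_lower_bound:
  fixes h :: "nat \<Rightarrow> real"
  assumes "C > 0" and pos: "\<And>k. k \<ge> 1 \<Longrightarrow> h k > 0"
    and lim: "(\<lambda>k. h k / (C * real k powr a)) \<longlonglongrightarrow> 1"
  obtains c where "c > 0" "\<And>k. k \<ge> 1 \<Longrightarrow> h k \<ge> c * real k powr a"
proof -
  let ?r = "\<lambda>k. h k / (C * real k powr a)"
  obtain N where N: "\<And>k. k \<ge> N \<Longrightarrow> ?r k > 1/2"
    using order_tendstoD(1)[OF lim, of "1/2"] by (auto simp: eventually_sequentially)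
  define c where "c = Min (insert (1/2) (?r ` {1..N}))"
  have rpos: "?r k > 0" if "k \<ge> 1" for k using pos[OF that] assms(1) that by simp
  have "c > 0" unfolding c_def using rpos by (subst Min_gr_iff) auto
  have cle: "c \<le> ?r k" if "k \<ge> 1" for k
  proof (cases "k \<le> N")
    case True
    then show ?thesis unfolding c_def using that by (intro Min_le) auto
  next
    case False
    have "c \<le> 1/2" unfolding c_def by (intro Min_le) auto
    with N[of k] False show ?thesis by linarith
  qed
  show thesis
  proof (rule that[of "c * C"])
    show "c * C > 0" using \<open>c > 0\<close> assms(1) by simp
    fix k :: nat assume k: "k \<ge> 1"
    then have "C * real k powr a > 0" using assms(1) by simp
    with cle[OF k] show "h k \<ge> c * C * real k powr a"
      by (simp add: pos_le_divide_eq mult.assoc)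
  qed
qed

section \<open>The tail at the optimal rate\<close>

text \<open>The three powers \<open>r\<close> (the rate), \<open>q\<close> (the size of the summands) and \<open>a\<close> satisfy \<open>r * q = a\<close>,
  \<open>a * r = n\<close> and \<open>a powr \<gamma> = r\<close>. Hence the event is a deviation of the sum by \<open>u * a\<close>, while the
  sum has range and variance of order \<open>n * q = a\<^sup>2\<close>.

  The exponent \<open>1 + \<gamma>\<close> is dictated by the upper end \<open>u \<sim> a\<close> of the possible range of \<open>u\<close>: there
  \<open>l\<close> must not exceed the order of \<open>1 / q\<close>, which permits \<open>l * u * a\<close> of order \<open>u * a / q = u * r\<close>, that is
  \<open>u * u powr \<gamma>\<close>.\<close>

lemma (in prob_space) tail_of_normalized_sum:
  fixes X :: "nat \<Rightarrow> 'a \<Rightarrow> real" and n :: nat and \<beta> d b v c u :: real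
  assumes n: "n \<ge> 1" and pos: "\<beta> > 0" "d > 0" "b > 0" "c > 0" and u: "u \<ge> 1"
    and indep: "indep_vars (\<lambda>_. borel) X {1..n}"
    and bound: "\<And>k \<omega>. k \<in> {1..n} \<Longrightarrow> \<omega> \<in> space M \<Longrightarrow>
      \<bar>X k \<omega>\<bar> \<le> b * real n powr (d / (2 * \<beta> + d))"
    and second: "\<And>k. k \<in> {1..n} \<Longrightarrow>
      expectation (\<lambda>\<omega>. (X k \<omega>)\<^sup>2) \<le> v * real n powr (d / (2 * \<beta> + d))"
    and c: "c * (2 * b) * max 1 (2 * b) \<le> 1" "c * v \<le> 1 / 2"
  shows "prob {\<omega> \<in> space M. real n powr (\<beta> / (2 * \<beta> + d)) *
      \<bar>1 / real n * (\<Sum>k=1..n. X k \<omega>) - expectation (\<lambda>\<omega>. 1 / real n * (\<Sum>k=1..n. X k \<omega>))\<bar> > u}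
      \<le> 2 * exp (- (c / 2) * u powr ((2 * \<beta> + d) / (\<beta> + d)))"
proof -
  define r where "r = real n powr (\<beta> / (2 * \<beta> + d))"
  define q where "q = real n powr (d / (2 * \<beta> + d))"
  define a where "a = real n powr ((\<beta> + d) / (2 * \<beta> + d))"
  define \<gamma> where "\<gamma> = \<beta> / (\<beta> + d)"
  have \<gamma>: "0 \<le> \<gamma>" "\<gamma> \<le> 1" using pos by (auto simp: \<gamma>_def)
  have rqa: "r > 0" "q > 0" "a > 0" using n by (auto simp: r_def q_def a_def)
  have "r * q = real n powr ((\<beta> + d) / (2 * \<beta> + d))"
    by (simp add: r_def q_def powr_add[symmetric] add_divide_distrib)
  then have rq: "r * q = a" by (simp add: a_def)
  have "a * r = real n powr ((\<beta> + d) / (2 * \<beta> + d) + \<beta> / (2 * \<beta> + d))"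
    by (simp add: r_def a_def powr_add)
  also have "(\<beta> + d) / (2 * \<beta> + d) + \<beta> / (2 * \<beta> + d) = 1"
    using pos by (simp add: add_divide_distrib[symmetric])
  finally have ar: "a * r = real n" using n by simp
  have a\<gamma>: "a powr \<gamma> = r"
    using pos by (simp add: a_def r_def \<gamma>_def powr_powr)
  have nq: "real n * q = a\<^sup>2" using ar rq by (metis mult.assoc power2_eq_square)
  have p: "(2 * \<beta> + d) / (\<beta> + d) = 1 + \<gamma>"
    using pos by (simp add: \<gamma>_def field_simps)
  let ?S = "\<lambda>\<omega>. \<Sum>k=1..n. X k \<omega>"
  let ?D = "\<lambda>\<omega>. \<bar>?S \<omega> - expectation ?S\<bar>"
  have norm: "r * \<bar>1 / real n * ?S \<omega> - expectation (\<lambda>\<omega>. 1 / real n * ?S \<omega>)\<bar> = ?D \<omega> / a" for \<omega>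
  proof -
    have "1 / real n * ?S \<omega> - expectation (\<lambda>\<omega>. 1 / real n * ?S \<omega>) = (?S \<omega> - expectation ?S) / real n"
      by (simp add: diff_divide_distrib)
    then show ?thesis using rqa by (simp add: ar[symmetric] abs_divide abs_mult)
  qed
  have [measurable]: "X k \<in> borel_measurable M" if "k \<in> {1..n}" for k
    using indep that by (auto simp: indep_vars_def)
  have Smeas: "?S \<in> borel_measurable M" by measurable
  have "prob {\<omega> \<in> space M. ?D \<omega> / a > u} \<le> 2 * exp (- (c / 2) * u powr (1 + \<gamma>))"
  proof (cases "u \<le> 2 * b * a")
    case False
    \<comment> \<open>The deviation would exceed what the bound on the summands allows: the event is empty.\<close>
    have Sb: "\<bar>?S \<omega>\<bar> \<le> b * a\<^sup>2" if "\<omega> \<in> space M" for \<omega>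
    proof -
      have "\<bar>?S \<omega>\<bar> \<le> (\<Sum>k=1..n. \<bar>X k \<omega>\<bar>)" by (rule sum_abs)
      also have "\<dots> \<le> real (card {1..n}) * (b * q)"
        using bound[OF _ that] by (intro sum_bounded_above) (auto simp: q_def)
      finally show ?thesis using nq by (simp add: algebra_simps)
    qed
    have "\<not> ?D \<omega> / a > u" if "\<omega> \<in> space M" for \<omega>
    proof -
      have "?D \<omega> \<le> 2 * b * a\<^sup>2"
        using Sb[OF that] bounded_random_variable(2)[OF Smeas Sb] by linarith
      then have "?D \<omega> / a \<le> 2 * b * a"
        using rqa by (simp add: pos_divide_le_eq power2_eq_square mult.assoc)
      then show ?thesis using False by linarith
    qed
    then have "{\<omega> \<in> space M. ?D \<omega> / a > u} = {}" by blast
    then show ?thesis by (simp only: measure_empty) simp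
  next
    case True
    \<comment> \<open>Chosen so that \<open>l * (u * a) = c * u powr (1 + \<gamma>)\<close>.\<close>
    define l where "l = c * u powr \<gamma> / a"
    have l0: "l > 0" using pos rqa u by (simp add: l_def)
    have "u powr \<gamma> \<le> (2 * b * a) powr \<gamma>" using True u \<gamma> by (intro powr_mono2) auto
    also have "\<dots> = (2 * b) powr \<gamma> * r" using pos rqa a\<gamma> by (simp add: powr_mult)
    also have "(2 * b) powr \<gamma> \<le> max 1 (2 * b)"
    proof -
      have "(2 * b) powr \<gamma> \<le> max 1 (2 * b) powr \<gamma>" using pos \<gamma> by (intro powr_mono2) auto
      also have "\<dots> \<le> max 1 (2 * b) powr 1" using \<gamma> by (intro powr_mono) auto
      finally show ?thesis by simp
    qed
    finally have u\<gamma>: "u powr \<gamma> \<le> max 1 (2 * b) * r" using rqa by simp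
    have "l * (2 * (b * q)) = (c * (2 * b) * q / a) * u powr \<gamma>" by (simp add: l_def)
    also have "\<dots> \<le> (c * (2 * b) * q / a) * (max 1 (2 * b) * r)"
      using u\<gamma> pos rqa by (intro mult_left_mono) auto
    also have "\<dots> = c * (2 * b) * max 1 (2 * b) * (r * q / a)" by simp
    also have "\<dots> \<le> 1" using c(1) rq rqa by simp
    finally have l1: "l * (2 * (b * q)) \<le> 1" .
    have "{\<omega> \<in> space M. ?D \<omega> / a > u} \<subseteq> {\<omega> \<in> space M. ?D \<omega> \<ge> u * a}"
      using rqa by (auto simp: pos_less_divide_eq)
    then have "prob {\<omega> \<in> space M. ?D \<omega> / a > u} \<le> prob {\<omega> \<in> space M. ?D \<omega> \<ge> u * a}"
      by (intro finite_measure_mono) measurable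
    also have "\<dots> \<le> 2 * exp (- l * (u * a) + l\<^sup>2 * (real (card {1..n}) * (v * q)))"
      by (rule tail_bounded_independent_sum[OF finite_atLeastAtMost indep _ _ l0 l1])
        (use bound second in \<open>auto simp: q_def\<close>)
    also have "\<dots> \<le> 2 * exp (- (c / 2) * u powr (1 + \<gamma>))"
    proof -
      have lin: "l * (u * a) = c * u powr (1 + \<gamma>)"
        using rqa u by (simp add: l_def powr_add)
      have "l\<^sup>2 * (real n * (v * q)) = l\<^sup>2 * (v * a\<^sup>2)"
        by (simp only: nq[symmetric] mult_ac)
      also have "\<dots> = (c * v) * (c * u powr (2 * \<gamma>))"
        using rqa u by (simp add: l_def power2_eq_square powr_add[symmetric] field_simps)
      also have "\<dots> \<le> 1 / 2 * (c * u powr (2 * \<gamma>))"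
        using c(2) pos by (intro mult_right_mono) auto
      \<comment> \<open>Here \<open>u \<ge> 1\<close> and \<open>\<gamma> \<le> 1\<close> give \<open>2 * \<gamma> \<le> 1 + \<gamma>\<close> and the comparison of powers.\<close>
      also have "\<dots> \<le> 1 / 2 * (c * u powr (1 + \<gamma>))"
        using pos u \<gamma> by (intro mult_left_mono powr_mono) auto
      finally show ?thesis using lin by simp
    qed
    finally show ?thesis .
  qed
  then show ?thesis using norm p by (simp add: r_def)
qed

lemma (in prob_space) density_of_distributed:
  assumes dist: "distributed M lborel \<xi> (\<lambda>x. ennreal (f x))" and "\<And>x. f x \<ge> 0"
  shows "f \<in> borel_measurable borel" and "(\<integral>\<^sup>+x. ennreal (f x) \<partial>lborel) = 1"
proof -
  have "(\<lambda>x. enn2real (ennreal (f x))) \<in> borel_measurable borel"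
    using distributed_borel_measurable[OF dist] by simp
  then show "f \<in> borel_measurable borel" using assms(2) by simp
  have "(\<integral>\<^sup>+x. ennreal (f x) * 1 \<partial>lborel) = (\<integral>\<^sup>+\<omega>. 1 \<partial>M)"
    by (rule distributed_nn_integral[OF dist]) simp
  then show "(\<integral>\<^sup>+x. ennreal (f x) \<partial>lborel) = 1" by (simp add: emeasure_space_1)
qed

theorem theorem2p1:
  fixes K :: "real ^ 'd::finite \<Rightarrow> real"
    and h :: "nat \<Rightarrow> real"
    and \<beta> L C\<^sub>2 :: real
  assumes "\<beta> > 0" and "L > 0" and "C\<^sub>2 > 0"
    and "kernel_conditions \<beta> K"
    and "\<And>k. k \<ge> 1 \<Longrightarrow> h k > 0"
    and "(\<lambda>k. h k / (C\<^sub>2 * real k powr (- 1 / (2 * \<beta> + real CARD('d))))) \<longlonglongrightarrow> 1"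
  shows "\<exists>C\<^sub>4>0. \<forall>(M :: 'w measure) (\<xi> :: nat \<Rightarrow> 'w \<Rightarrow> real ^ 'd) (f :: real ^ 'd \<Rightarrow> real).
           prob_space M \<longrightarrow>
           prob_space.indep_vars M (\<lambda>_. borel) \<xi> {1..} \<longrightarrow>
           (\<forall>x. f x \<ge> 0) \<longrightarrow>
           (\<forall>k\<ge>1. distributed M lborel (\<xi> k) (\<lambda>x. ennreal (f x))) \<longrightarrow>
           f \<in> smooth_class \<beta> L \<longrightarrow>
           (\<forall>u\<ge>1. (SUP n\<in>{1..}. WW_tail M \<beta> K h \<xi> n u)
              \<le> 2 * exp (- C\<^sub>4 * u powr ((2 * \<beta> + real CARD('d)) / (\<beta> + real CARD('d)))))"
proof -
  let ?d = "real CARD('d)"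
  let ?D = "2 * \<beta> + ?d"
  have d: "?d > 0" by simp
  have [measurable]: "K \<in> borel_measurable borel" and K2: "integrable lborel (\<lambda>x. (K x)\<^sup>2)"
    and "bounded (range K)"
    using assms(4) by (auto simp: kernel_conditions_def bcontfun_def)
  then obtain B where B: "B > 0" "\<And>x. \<bar>K x\<bar> \<le> B"
    unfolding bounded_pos by auto
  obtain F where F: "F > 0" and
    f_le: "\<And>f :: real ^ 'd \<Rightarrow> real. \<And>x. f \<in> smooth_class \<beta> L \<Longrightarrow> f \<in> borel_measurable borel \<Longrightarrow>
       (\<And>x. f x \<ge> 0) \<Longrightarrow> (\<integral>\<^sup>+x. ennreal (f x) \<partial>lborel) \<le> 1 \<Longrightarrow> f x \<le> F"
    using smooth_densities_uniformly_bounded[OF assms(1,2)] by metis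
  obtain c0 where c0: "c0 > 0" and h_ge: "\<And>k. k \<ge> 1 \<Longrightarrow> h k \<ge> c0 * real k powr (- 1 / ?D)"
    using bandwidth_lower_bound[OF assms(3,5,6)] by metis
  have h_inv: "1 / h k ^ CARD('d) \<le> 1 / c0 ^ CARD('d) * real n powr (?d / ?D)" if "k \<in> {1..n}" for k n
  proof -
    have k: "k \<ge> 1" "k \<le> n" using that by auto
    have "1 / h k ^ CARD('d) \<le> 1 / (c0 * real k powr (- 1 / ?D)) ^ CARD('d)"
      using h_ge[OF k(1)] assms(5)[OF k(1)] c0 k by (intro divide_left_mono power_mono) auto
    also have "\<dots> = 1 / c0 ^ CARD('d) * real k powr (?d / ?D)"
      using k by (simp add: power_mult_distrib powr_power powr_minus field_simps)
    also have "\<dots> \<le> 1 / c0 ^ CARD('d) * real n powr (?d / ?D)"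
      using k assms(1) c0 by (intro mult_left_mono powr_mono2) auto
    finally show ?thesis .
  qed
  define I where "I = (LINT x|lborel. (K x)\<^sup>2)"
  have I: "I \<ge> 0" by (simp add: I_def)
  define b where "b = B / c0 ^ CARD('d)"
  define v where "v = F * I / c0 ^ CARD('d)"
  have b: "b > 0" and v: "v \<ge> 0" using B F I c0 by (auto simp: b_def v_def)
  \<comment> \<open>The two entries make the two smallness conditions of \<open>tail_of_normalized_sum\<close> hold; the
    summand \<open>1\<close> keeps the second denominator positive when \<open>v = 0\<close>.\<close>
  define c where "c = min (1 / (2 * b * max 1 (2 * b))) (1 / (2 * (v + 1)))"
  have c: "c > 0" using b v by (auto simp: c_def)
  have c1: "c * (2 * b) * max 1 (2 * b) \<le> 1"
  proof -
    have "c * (2 * b * max 1 (2 * b)) \<le> 1 / (2 * b * max 1 (2 * b)) * (2 * b * max 1 (2 * b))"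
      using b by (intro mult_right_mono) (auto simp: c_def)
    moreover have "max 1 (2 * b) \<noteq> 0" by linarith
    ultimately show ?thesis using b by (simp add: mult.assoc)
  qed
  have c2: "c * v \<le> 1 / 2"
  proof -
    have "c * v \<le> 1 / (2 * (v + 1)) * (v + 1)"
      using c v by (intro mult_mono) (auto simp: c_def)
    also have "\<dots> = 1 / 2" using v by (simp add: field_simps)
    finally show ?thesis .
  qed
  show ?thesis
  proof (intro exI[of _ "c / 2"] conjI allI impI)
    show "c / 2 > 0" using c by simp
  next
    fix M :: "'w measure" and \<xi> :: "nat \<Rightarrow> 'w \<Rightarrow> real ^ 'd" and f :: "real ^ 'd \<Rightarrow> real" and u :: real
    assume M: "prob_space M" and indep: "prob_space.indep_vars M (\<lambda>_. borel) \<xi> {1..}"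
      and f0: "\<forall>x. f x \<ge> 0" and dist: "\<forall>k\<ge>1. distributed M lborel (\<xi> k) (\<lambda>x. ennreal (f x))"
      and f: "f \<in> smooth_class \<beta> L" and u: "u \<ge> 1"
    interpret prob_space M by (rule M)
    have fF: "f x \<le> F" for x
      using f_le[OF f] density_of_distributed[of "\<xi> 1" f] dist f0 by auto
    show "(SUP n\<in>{1..}. WW_tail M \<beta> K h \<xi> n u) \<le> 2 * exp (- (c / 2) * u powr (?D / (\<beta> + ?d)))"
    proof (rule cSUP_least)
      fix n :: nat assume "n \<in> {1..}"
      then have n: "n \<ge> 1" by simp
      show "WW_tail M \<beta> K h \<xi> n u \<le> 2 * exp (- (c / 2) * u powr (?D / (\<beta> + ?d)))"
        unfolding WW_tail_def WW_rate_def WW_estimator_def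
      proof (intro cSUP_least tail_of_normalized_sum[OF n assms(1) d b c u _ _ _ c1 c2])
        fix x
        let ?X = "\<lambda>k \<omega>. 1 / h k ^ CARD('d) * K ((x - \<xi> k \<omega>) /\<^sub>R h k)"
        have "indep_vars (\<lambda>_. borel) \<xi> {1..n}"
          using indep by (rule indep_vars_subset) auto
        then show "indep_vars (\<lambda>_. borel) ?X {1..n}"
          by (rule indep_vars_compose2[where Y = "\<lambda>k y. 1 / h k ^ CARD('d) * K ((x - y) /\<^sub>R h k)"])
            measurable
        fix k assume k: "k \<in> {1..n}"
        then have hk: "h k > 0" using assms(5) by simp
        show "\<bar>?X k \<omega>\<bar> \<le> b * real n powr (?d / ?D)" for \<omega>
        proof -
          have "\<bar>?X k \<omega>\<bar> = 1 / h k ^ CARD('d) * \<bar>K ((x - \<xi> k \<omega>) /\<^sub>R h k)\<bar>"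
            using hk by (simp add: abs_mult)
          also have "\<dots> \<le> (1 / c0 ^ CARD('d) * real n powr (?d / ?D)) * B"
            using h_inv[OF k] B hk c0 by (intro mult_mono) auto
          finally show ?thesis by (simp add: b_def mult_ac)
        qed
        have "expectation (\<lambda>\<omega>. (?X k \<omega>)\<^sup>2) \<le> F * I / h k ^ CARD('d)"
          unfolding I_def using dist k F hk K2 fF
          by (intro kernel_summand_second_moment[where f = f]) auto
        also have "\<dots> = F * I * (1 / h k ^ CARD('d))" by simp
        also have "\<dots> \<le> F * I * (1 / c0 ^ CARD('d) * real n powr (?d / ?D))"
          using h_inv[OF k] F I by (intro mult_left_mono) auto
        finally show "expectation (\<lambda>\<omega>. (?X k \<omega>)\<^sup>2) \<le> v * real n powr (?d / ?D)"
          by (simp add: v_def)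
      qed simp
    qed simp
  qed
qed

end
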